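(* Let $d\ge 3$, $k\ge 2$ be integers and let $\{\Omega_n\}_{n\in\mathbb N}$ be a sequence of finite connected $d$-regular graphs which is an expander, is dg-bounded, and has large girth. Let $\Omega=\bigsqcup_n\Omega_n$. Let $n\ge 1$ and let $B_n$ be the braid group on $n$ strands. Then for every integer $j\ge 1$, for almost every $\alpha\in\mathcal A(\Omega,T^j)$, every group homomorphism $\Gamma_\alpha\to B_n$ has finite image.
   Context: Graphs. For a finite connected graph $\Omega$, $|\Omega|$ is the number of vertices and the Cheeger constant is $h(\Omega)=\min_{1\le |A|\le |\Omega|/2}|\partial A|/|A|$, where $A$ ranges over sets of vertices and $\partial A$ is the set of edges between $A$ and its complement. A sequence $\{\Omega_n\}$ of finite connected graphs of uniformly bounded degree is an expander if $|\Omega_n|\to\infty$ and there is $c>0$ with $h(\Omega_n)\ge c$ for all $n$. The girth of a graph is the edge-length of its shortest non-trivial cycle; the diameter is the greatest edge-length distance between two vertices. The sequence has large girth if $\mathrm{girth}(\Omega_n)\to\infty$, and is dg-bounded if there is $D>0$ with $\mathrm{diam}(\Omega_n)\le D\,\mathrm{girth}(\Omega_n)$ for all $n$. Random monster group. $F_k$ is the free group of rank $k$ with symmetric generating set $T$ of size $2k$ (a free basis and its inverses), and $T^j\subset F_k$ is the set of elements of the form $t_1\cdots t_j$ with $t_i\in T$. A symmetric $F_k$-labelling of a graph is a map $\alpha$ from its oriented edges to $F_k$ with $\alpha(e^{-1})=\alpha(e)^{-1}$ for every edge $e$. $\mathcal A(\Omega,T^j)$ is the set of symmetric $F_k$-labellings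 of $\Omega$ with values in $T^j$; for $\Omega=\bigsqcup_n\Omega_n$ it is given the product of the uniform probability distributions on the finite sets $\mathcal A(\Omega_n,T^j)$, and "almost every" refers to this probability. For $\alpha\in\mathcal A(\Omega,T^j)$, $\Gamma_\alpha$ is the quotient of $F_k$ by the normal closure of all elements $\alpha(e_1)\cdots\alpha(e_m)$, where $e_1\cdots e_m$ is a closed path in $\Omega$. *)

theory Defs
  imports
    "HOL-Algebra.Algebra"
    "HOL-Probability.Probability"
    "Graph_Theory.Graph_Theory"
begin

section \<open>Free groups and presentations\<close>

text \<open>
  A letter \<open>(x, True)\<close> stands for the generator \<open>x\<close>, and \<open>(x, False)\<close> for its inverse.
  Elements of the free group are the freely reduced words; \<open>push l w\<close> is the reduced form of
  \<open>l # w\<close> when \<open>w\<close> is reduced.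
\<close>

type_synonym 'a word = "('a \<times> bool) list"

definition inv_letter :: "'a \<times> bool \<Rightarrow> 'a \<times> bool" where
  "inv_letter l = (fst l, \<not> snd l)"

definition reduced :: "'a word \<Rightarrow> bool" where
  "reduced w \<longleftrightarrow> (\<forall>i. Suc i < length w \<longrightarrow> w ! Suc i \<noteq> inv_letter (w ! i))"

fun push :: "'a \<times> bool \<Rightarrow> 'a word \<Rightarrow> 'a word" where
  "push l [] = [l]"
| "push l (m # w) = (if m = inv_letter l then w else l # m # w)"

definition free_group :: "'a set \<Rightarrow> 'a word monoid" where
  "free_group S =
    \<lparr> carrier = {w. reduced w \<and> fst ` set w \<subseteq> S},
      monoid.mult = (\<lambda>u v. foldr push u v),
      monoid.one = [] \<rparr>"

lemma inv_letter_inv_letter [simp]: "inv_letter (inv_letter l) = l"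
  by (simp add: inv_letter_def)

lemma inv_letter_neq [simp]: "inv_letter l \<noteq> l"
  by (simp add: inv_letter_def prod_eq_iff)

lemma fst_inv_letter [simp]: "fst (inv_letter l) = fst l"
  by (simp add: inv_letter_def)

lemma reduced_Nil [simp]: "reduced []"
  by (simp add: reduced_def)

lemma reduced_Cons:
  "reduced (l # w) \<longleftrightarrow> reduced w \<and> (w \<noteq> [] \<longrightarrow> hd w \<noteq> inv_letter l)"
  unfolding reduced_def
  by (cases w) (auto simp: nth_Cons split: nat.splits)

lemma reduced_push: "reduced w \<Longrightarrow> reduced (push l w)"
  by (cases w) (auto simp: reduced_Cons)

lemma reduced_foldr_push: "reduced w \<Longrightarrow> reduced (foldr push u w)"
  by (induction u) (auto simp: reduced_push)

lemma set_push: "set (push l w) \<subseteq> insert l (set w)"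
  by (cases w) auto

lemma set_foldr_push: "set (foldr push u w) \<subseteq> set u \<union> set w"
proof (induction u)
  case (Cons l u)
  then show ?case using set_push[of l "foldr push u w"] by auto
qed simp

lemma push_push_inv_letter:
  assumes "reduced w" shows "push l (push (inv_letter l) w) = w"
proof (cases w)
  case (Cons m v)
  with assms show ?thesis by (cases v) (auto simp: reduced_Cons)
qed simp

lemma push_inv_letter_push:
  assumes "reduced w" shows "push (inv_letter l) (push l w) = w"
  using push_push_inv_letter[OF assms, of "inv_letter l"] by simp

lemma foldr_push_push:
  assumes "reduced w"
  shows "foldr push (push l u) w = push l (foldr push u w)"
proof (cases u)
  case (Cons m v)
  then show ?thesis
    using push_push_inv_letter[OF reduced_foldr_push[OF assms]] by auto
qed simp

lemma foldr_push_assoc: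
  assumes "reduced w"
  shows "foldr push (foldr push u v) w = foldr push u (foldr push v w)"
  by (induction u) (simp_all add: foldr_push_push assms)

lemma foldr_push_Nil: "reduced u \<Longrightarrow> foldr push u [] = u"
proof (induction u)
  case (Cons l u)
  then show ?case by (cases u) (auto simp: reduced_Cons)
qed simp

lemma foldr_push_inverse:
  "reduced w \<Longrightarrow> foldr push (rev (map inv_letter u)) (foldr push u w) = w"
  by (induction u arbitrary: w)
     (simp_all add: push_inv_letter_push reduced_foldr_push)

lemma foldr_push_in_carrier:
  assumes "u \<in> carrier (free_group S)" "fst ` set v \<subseteq> S"
  shows "foldr push v u \<in> carrier (free_group S)"
  using assms set_foldr_push[of v u]
  by (auto simp: free_group_def reduced_foldr_push dest!: subsetD)

lemma group_free_group: "group (free_group S)"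
proof (rule groupI)
  fix u assume u: "u \<in> carrier (free_group S)"
  define v where "v = foldr push (rev (map inv_letter u)) []"
  have "v \<in> carrier (free_group S)"
    unfolding v_def using u
    by (intro foldr_push_in_carrier) (auto simp: free_group_def)
  moreover have "v \<otimes>\<^bsub>free_group S\<^esub> u = \<one>\<^bsub>free_group S\<^esub>"
    using u foldr_push_assoc[of u "rev (map inv_letter u)" "[]"]
      foldr_push_inverse[of "[]" u]
    by (simp add: v_def free_group_def foldr_push_Nil)
  ultimately show "\<exists>v\<in>carrier (free_group S). v \<otimes>\<^bsub>free_group S\<^esub> u = \<one>\<^bsub>free_group S\<^esub>"
    by blast
next
  fix u v assume "u \<in> carrier (free_group S)" "v \<in> carrier (free_group S)"
  then show "u \<otimes>\<^bsub>free_group S\<^esub> v \<in> carrier (free_group S)"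
    using foldr_push_in_carrier[of v S u] by (simp add: free_group_def)
qed (auto simp: free_group_def foldr_push_assoc)

definition generator :: "'a \<Rightarrow> 'a word" where
  "generator x = [(x, True)]"

definition group_prod :: "('a, 'b) monoid_scheme \<Rightarrow> 'a list \<Rightarrow> 'a" where
  "group_prod G xs = foldr (\<lambda>x y. x \<otimes>\<^bsub>G\<^esub> y) xs \<one>\<^bsub>G\<^esub>"

definition normal_closure :: "('a, 'b) monoid_scheme \<Rightarrow> 'a set \<Rightarrow> 'a set" where
  "normal_closure G R = (\<lambda>N. N \<lhd> G) hull R"

definition presented_group :: "'a set \<Rightarrow> 'a word set \<Rightarrow> 'a word set monoid" where
  "presented_group S R = free_group S Mod normal_closure (free_group S) R"

text \<open>Artin's presentation, with the generators \<open>\<sigma> 1, \<dots>, \<sigma> (n - 1)\<close>.\<close>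

definition braid_group :: "nat \<Rightarrow> nat word set monoid" where
  "braid_group n =
    (let F = free_group {1..<n}; \<sigma> = generator in
     presented_group {1..<n}
      ({(\<sigma> i \<otimes>\<^bsub>F\<^esub> \<sigma> j) \<otimes>\<^bsub>F\<^esub> inv\<^bsub>F\<^esub> (\<sigma> j \<otimes>\<^bsub>F\<^esub> \<sigma> i) | i j.
          1 \<le> i \<and> i + 2 \<le> j \<and> j < n} \<union>
       {(\<sigma> i \<otimes>\<^bsub>F\<^esub> \<sigma> (i + 1) \<otimes>\<^bsub>F\<^esub> \<sigma> i) \<otimes>\<^bsub>F\<^esub> inv\<^bsub>F\<^esub> (\<sigma> (i + 1) \<otimes>\<^bsub>F\<^esub> \<sigma> i \<otimes>\<^bsub>F\<^esub> \<sigma> (i + 1)) | i.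
          1 \<le> i \<and> i + 1 < n}))"

section \<open>Graphs\<close>

text \<open>
  An undirected graph is given by its oriented edges (the arcs of a digraph) together with the
  orientation reversal \<open>r\<close>, subject to \<^locale>\<open>bidirected_digraph\<close>. Loops and multiple edges are
  permitted; an edge is a pair \<open>{e, r e}\<close> of distinct arcs, so a loop adds 2 to the
  \<^const>\<open>out_degree\<close> of its vertex.

  Girth, diameter and Cheeger constant are extended reals, an infimum over the empty set being
  \<open>\<infinity>\<close>.
\<close>

text \<open>Each edge between \<open>A\<close> and its complement has exactly one orientation that leaves \<open>A\<close>.\<close>

definition edge_boundary :: "('v, 'e) pre_digraph \<Rightarrow> 'v set \<Rightarrow> 'e set" where
  "edge_boundary G A = {e \<in> arcs G. tail G e \<in> A \<and> head G e \<notin> A}"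

definition cheeger_constant :: "('v, 'e) pre_digraph \<Rightarrow> ereal" where
  "cheeger_constant G =
    (INF A \<in> {A. A \<subseteq> verts G \<and> 1 \<le> card A \<and> real (card A) \<le> real (card (verts G)) / 2}.
      ereal (real (card (edge_boundary G A)) / real (card A)))"

text \<open>
  \<^const>\<open>pre_digraph.cycle\<close> admits the walk \<open>[e, r e]\<close> that traverses one edge back and forth;
  since the vertices of a cycle are distinct, this is the only backtracking it allows.
\<close>

definition girth :: "('v, 'e) pre_digraph \<Rightarrow> ('e \<Rightarrow> 'e) \<Rightarrow> ereal" where
  "girth G r =
    (INF p \<in> {p. pre_digraph.cycle G p \<and> (\<forall>e. p \<noteq> [e, r e])}. ereal (real (length p)))"

definition graph_diameter :: "('v, 'e) pre_digraph \<Rightarrow> ereal" where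
  "graph_diameter G =
    (SUP (u, v) \<in> verts G \<times> verts G. wf_digraph.\<mu> G (\<lambda>_. 1) u v)"

definition expander :: "(nat \<Rightarrow> ('v, 'e) pre_digraph) \<Rightarrow> bool" where
  "expander \<Omega> \<longleftrightarrow>
    (\<exists>b. \<forall>n. \<forall>v \<in> verts (\<Omega> n). out_degree (\<Omega> n) v \<le> b) \<and>
    filterlim (\<lambda>n. card (verts (\<Omega> n))) at_top sequentially \<and>
    (\<exists>c::real. c > 0 \<and> (\<forall>n. cheeger_constant (\<Omega> n) \<ge> ereal c))"

definition large_girth :: "(nat \<Rightarrow> ('v, 'e) pre_digraph) \<Rightarrow> (nat \<Rightarrow> 'e \<Rightarrow> 'e) \<Rightarrow> bool" where
  "large_girth \<Omega> r \<longleftrightarrow> (\<lambda>n. girth (\<Omega> n) (r n)) \<longlonglongrightarrow> \<infinity>"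

definition dg_bounded :: "(nat \<Rightarrow> ('v, 'e) pre_digraph) \<Rightarrow> (nat \<Rightarrow> 'e \<Rightarrow> 'e) \<Rightarrow> bool" where
  "dg_bounded \<Omega> r \<longleftrightarrow>
    (\<exists>D::real. D > 0 \<and> (\<forall>n. graph_diameter (\<Omega> n) \<le> ereal D * girth (\<Omega> n) (r n)))"

definition disjoint_union :: "(nat \<Rightarrow> ('v, 'e) pre_digraph) \<Rightarrow> (nat \<times> 'v, nat \<times> 'e) pre_digraph" where
  "disjoint_union \<Omega> =
    \<lparr> verts = (SIGMA n:UNIV. verts (\<Omega> n)),
      arcs = (SIGMA n:UNIV. arcs (\<Omega> n)),
      tail = (\<lambda>(n, e). (n, tail (\<Omega> n) e)),
      head = (\<lambda>(n, e). (n, head (\<Omega> n) e)) \<rparr>"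

section \<open>The random group\<close>

text \<open>The free group of rank \<open>k\<close>, with \<open>T\<close> its free basis and their inverses.\<close>

definition free_group_rank :: "nat \<Rightarrow> nat word monoid" where
  "free_group_rank k = free_group {..<k}"

definition sym_generators :: "nat \<Rightarrow> nat word set" where
  "sym_generators k =
    generator ` {..<k} \<union> (\<lambda>i. inv\<^bsub>free_group_rank k\<^esub> (generator i)) ` {..<k}"

definition sym_generators_power :: "nat \<Rightarrow> nat \<Rightarrow> nat word set" where
  "sym_generators_power k j =
    {group_prod (free_group_rank k) ts | ts. length ts = j \<and> set ts \<subseteq> sym_generators k}"

text \<open>
  Labellings are taken to be \<open>undefined\<close> off the arcs, so that the labellings of a finite graph
  form a finite set.
\<close>

definition labellings ::
    "nat \<Rightarrow> ('v, 'e) pre_digraph \<Rightarrow> ('e \<Rightarrow> 'e) \<Rightarrow> nat word set \<Rightarrow> ('e \<Rightarrow> nat word) set" where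
  "labellings k G r L =
    {\<alpha> \<in> arcs G \<rightarrow>\<^sub>E L. \<forall>e \<in> arcs G. \<alpha> (r e) = inv\<^bsub>free_group_rank k\<^esub> (\<alpha> e)}"

text \<open>
  A labelling of the disjoint union is a family of labellings \<open>\<alpha> n\<close>, one for each \<open>\<Omega> n\<close>.
\<close>

definition random_labelling ::
    "nat \<Rightarrow> (nat \<Rightarrow> ('v, 'e) pre_digraph) \<Rightarrow> (nat \<Rightarrow> 'e \<Rightarrow> 'e) \<Rightarrow> nat \<Rightarrow> (nat \<Rightarrow> 'e \<Rightarrow> nat word) measure" where
  "random_labelling k \<Omega> r j =
    (\<Pi>\<^sub>M n\<in>UNIV. uniform_count_measure (labellings k (\<Omega> n) (r n) (sym_generators_power k j)))"

definition closed_path_labels ::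
    "nat \<Rightarrow> ('v, 'e) pre_digraph \<Rightarrow> ('e \<Rightarrow> nat word) \<Rightarrow> nat word set" where
  "closed_path_labels k G \<alpha> =
    {group_prod (free_group_rank k) (map \<alpha> p) | u p. pre_digraph.awalk G u p u}"

definition monster_group ::
    "nat \<Rightarrow> (nat \<Rightarrow> ('v, 'e) pre_digraph) \<Rightarrow> (nat \<Rightarrow> 'e \<Rightarrow> nat word) \<Rightarrow> nat word set monoid" where
  "monster_group k \<Omega> \<alpha> =
    free_group_rank k Mod
      normal_closure (free_group_rank k)
        (closed_path_labels k (disjoint_union \<Omega>) (\<lambda>(n, e). \<alpha> n e))"

end

theory Submission
  imports Defs
begin

text \<open>
  The argument works for every countable target group \<open>H\<close>; the braid group is countable, being a
  quotient of a free group of finite rank.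

  A homomorphism from the random group \<open>\<Gamma>\<^sub>\<alpha>\<close> to \<open>H\<close> is the same as a homomorphism
  \<open>\<rho> : F\<^sub>k \<rightarrow> H\<close> that kills the labels of all closed paths. There are only countably many \<open>\<rho>\<close>,
  and the set of all \<open>\<rho>\<close> does not depend on \<open>\<alpha>\<close>. Hence it suffices to show that a single \<open>\<rho>\<close>
  with infinite image almost surely fails to kill the label of some closed path
  (lemma \<open>AE_closed_path_label_survives\<close>).

  Such a \<open>\<rho>\<close> is not constant on the finite set \<open>T\<^sup>j\<close>: otherwise it would be constant on \<open>T\<close>, and
  its image would have at most two elements (\<open>finite_image_if_constant_on_power\<close>). Each graph
  \<open>\<Omega> n\<close> is finite with all degrees at least two, so it contains a closed walk that traverses
  some edge exactly once (\<open>exists_closed_walk_traversing_edge_once\<close>). Once the labels of all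
  other edges are chosen, at least one of the values in \<open>T\<^sup>j\<close> for that edge gives the walk a
  label not killed by \<open>\<rho>\<close> (\<open>card_labellings_killed_le\<close>). So the label is killed with probability
  at most \<open>c = 1 - 1 / |T\<^sup>j|\<close>, which does not depend on \<open>n\<close>. The labellings of the different
  \<open>\<Omega> n\<close> are independent, so the probability that none of these labels survives is at most
  \<open>c\<^sup>N\<close> for every \<open>N\<close>, that is, zero (\<open>AE_PiM_ex_notin\<close>).
\<close>

section \<open>Homomorphisms out of free groups and quotients\<close>

lemma free_group_simps:
  "u \<otimes>\<^bsub>free_group S\<^esub> v = foldr push u v"
  "\<one>\<^bsub>free_group S\<^esub> = []"
  "w \<in> carrier (free_group S) \<longleftrightarrow> reduced w \<and> fst ` set w \<subseteq> S"
  by (simp_all add: free_group_def)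

lemma inv_free_group_letter:
  assumes "fst l \<in> S"
  shows "inv\<^bsub>free_group S\<^esub> [l] = [inv_letter l]"
  using assms
  by (intro group.inv_equality[OF group_free_group])
     (auto simp: free_group_simps reduced_Cons)

lemma hom_free_group_Cons:
  assumes "\<rho> \<in> hom (free_group S) H" and "l # w \<in> carrier (free_group S)"
  shows "\<rho> (l # w) = \<rho> [l] \<otimes>\<^bsub>H\<^esub> \<rho> w"
proof -
  have red: "reduced (l # w)"
    using assms(2) by (simp add: free_group_simps)
  have "[l] \<otimes>\<^bsub>free_group S\<^esub> w = l # w"
    using red by (cases w) (auto simp: free_group_simps reduced_Cons)
  moreover have "[l] \<in> carrier (free_group S)" "w \<in> carrier (free_group S)"
    using assms(2) by (auto simp: free_group_simps reduced_Cons)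
  ultimately show ?thesis
    using hom_mult[OF assms(1)] by metis
qed

lemma hom_free_group_eqI:
  assumes "group H"
    and \<rho>: "\<rho> \<in> hom (free_group S) H" and \<sigma>: "\<sigma> \<in> hom (free_group S) H"
    and letters: "\<And>l. fst l \<in> S \<Longrightarrow> \<rho> [l] = \<sigma> [l]"
    and "w \<in> carrier (free_group S)"
  shows "\<rho> w = \<sigma> w"
  using assms(5)
proof (induction w)
  case Nil
  then show ?case
    using hom_one[OF \<rho> group_free_group assms(1)] hom_one[OF \<sigma> group_free_group assms(1)]
    by (simp add: free_group_simps)
next
  case (Cons l w)
  then have "\<rho> w = \<sigma> w" and "fst l \<in> S"
    by (auto simp: free_group_simps reduced_Cons)
  then show ?case
    using hom_free_group_Cons[OF \<rho> Cons.prems] hom_free_group_Cons[OF \<sigma> Cons.prems] letters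
    by simp
qed

text \<open>
  A homomorphism on a free group of finite rank is determined by the values of finitely many
  letters, so there are only countably many of them into a given countable group.
\<close>

lemma countable_hom_free_group:
  assumes "group H" and "countable (carrier H)" and "finite S"
  shows "countable ((\<lambda>\<rho>. restrict \<rho> (carrier (free_group S))) ` hom (free_group S) H)"
    (is "countable ?R")
proof -
  let ?F = "free_group S"
  let ?val = "\<lambda>\<rho>. \<lambda>l\<in>S \<times> (UNIV :: bool set). \<rho> [l]"
  have letter: "[l] \<in> carrier ?F" if "fst l \<in> S" for l
    using that by (simp add: free_group_simps reduced_Cons)
  have "inj_on ?val ?R"
  proof (rule inj_onI, clarify)
    fix \<rho> \<sigma>
    assume \<rho>: "\<rho> \<in> hom ?F H" and \<sigma>: "\<sigma> \<in> hom ?F H"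
      and eq: "?val (restrict \<rho> (carrier ?F)) = ?val (restrict \<sigma> (carrier ?F))"
    have "\<rho> [l] = \<sigma> [l]" if "fst l \<in> S" for l
    proof -
      have "l \<in> S \<times> UNIV" using that by (cases l) simp
      then show ?thesis using fun_cong[OF eq, of l] letter[OF that] by simp
    qed
    then show "restrict \<rho> (carrier ?F) = restrict \<sigma> (carrier ?F)"
      using hom_free_group_eqI[OF assms(1) \<rho> \<sigma>] by (intro restrict_ext) blast
  qed
  moreover have "?val ` ?R \<subseteq> S \<times> UNIV \<rightarrow>\<^sub>E carrier H"
    using letter by (intro image_subsetI restrict_PiE_iff[THEN iffD2] ballI) (auto simp: hom_def)
  moreover have "countable (S \<times> (UNIV :: bool set) \<rightarrow>\<^sub>E carrier H)"
    using assms by (intro countable_PiE) auto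
  ultimately show ?thesis
    by (meson countable_image_inj_on countable_subset)
qed

text \<open>
  The hypothesis makes the family of normal subgroups containing \<open>R\<close> nonempty; for other \<open>R\<close>
  the hull is an empty intersection, hence the universal set.
\<close>

lemma (in group) normal_normal_closure:
  assumes "R \<subseteq> carrier G"
  shows "normal_closure G R \<lhd> G"
proof -
  have ne: "{N. N \<lhd> G \<and> R \<subseteq> N} \<noteq> {}"
    using normal_invI[OF subgroup_self] assms by auto
  have "subgroup (\<Inter>{N. N \<lhd> G \<and> R \<subseteq> N}) G"
    using ne by (intro subgroups_Inter) (auto intro: normal_imp_subgroup)
  then show ?thesis
    unfolding normal_closure_def hull_def
    by (rule normal_invI) (auto intro: normal.inv_op_closed2)
qed

lemma (in group) normal_closure_superset: "R \<subseteq> normal_closure G R"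
  unfolding normal_closure_def by (rule hull_subset)

text \<open>
  A homomorphism on the quotient by the normal closure of \<open>R\<close>, regarded as a homomorphism on
  the group itself.
\<close>

lemma (in group) hom_Mod_normal_closure:
  fixes h R
  defines "\<rho> \<equiv> \<lambda>x. h (normal_closure G R #> x)"
  assumes R: "R \<subseteq> carrier G" and "group H" and h: "h \<in> hom (G Mod normal_closure G R) H"
  shows "\<rho> \<in> hom G H"
    and "h ` carrier (G Mod normal_closure G R) = \<rho> ` carrier G"
    and "\<And>x. x \<in> R \<Longrightarrow> \<rho> x = \<one>\<^bsub>H\<^esub>"
proof -
  interpret N: normal "normal_closure G R" G
    by (rule normal_normal_closure[OF R])
  show "\<rho> \<in> hom G H"
    using Group.hom_compose[OF N.r_coset_hom_Mod h] by (simp add: \<rho>_def comp_def)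
  show "h ` carrier (G Mod normal_closure G R) = \<rho> ` carrier G"
    by (auto simp: \<rho>_def FactGroup_def RCOSETS_def)
  show "\<rho> x = \<one>\<^bsub>H\<^esub>" if "x \<in> R" for x
  proof -
    have "normal_closure G R #> x = \<one>\<^bsub>G Mod normal_closure G R\<^esub>"
      using that R normal_closure_superset[of R] N.rcos_const by auto
    then show ?thesis
      using hom_one[OF h N.factorgroup_is_group \<open>group H\<close>] by (simp add: \<rho>_def)
  qed
qed

lemma group_braid_group: "group (braid_group m)"
  and countable_braid_group: "countable (carrier (braid_group m))"
proof -
  let ?F = "free_group {1..<m}"
  interpret F: group ?F by (rule group_free_group)
  \<comment> \<open>The simplifier rewrites the lower bound \<open>1\<close> of the index set to \<open>Suc 0\<close>.\<close>
  interpret F': group "free_group {Suc 0..<m}" by (rule group_free_group)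
  have gen: "generator i \<in> carrier (free_group {Suc 0..<m})" if "1 \<le> i" "i < m" for i
    using that by (simp add: generator_def free_group_simps reduced_Cons)
  have "\<exists>R \<subseteq> carrier ?F. braid_group m = ?F Mod normal_closure ?F R"
    unfolding braid_group_def presented_group_def Let_def
    by (rule exI, rule conjI[OF _ refl]) (auto intro!: F'.m_closed F'.inv_closed gen)
  then obtain R where R: "R \<subseteq> carrier ?F" and B: "braid_group m = ?F Mod normal_closure ?F R"
    by blast
  show "group (braid_group m)"
    unfolding B by (intro normal.factorgroup_is_group F.normal_normal_closure R)
  show "countable (carrier (braid_group m))"
    by (simp add: B FactGroup_def RCOSETS_def UNION_singleton_eq_range)
qed

section \<open>Generators and their products\<close>

lemma sym_generators_eq: "sym_generators k = (\<lambda>l. [l]) ` ({..<k} \<times> UNIV)"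
proof -
  have "inv\<^bsub>free_group_rank k\<^esub> (generator i) = [(i, False)]" if "i < k" for i
    using inv_free_group_letter[of "(i, True)" "{..<k}"] that
    by (simp add: free_group_rank_def generator_def inv_letter_def)
  then show ?thesis
    by (auto simp: sym_generators_def generator_def image_iff Bex_def)
qed

lemma group_free_group_rank: "group (free_group_rank k)"
  by (simp add: free_group_rank_def group_free_group)

lemma sym_generators_subset: "sym_generators k \<subseteq> carrier (free_group_rank k)"
  by (auto simp: sym_generators_eq free_group_rank_def free_group_simps reduced_Cons)

lemma inv_sym_generators:
  "t \<in> sym_generators k \<Longrightarrow> inv\<^bsub>free_group_rank k\<^esub> t \<in> sym_generators k"
  by (auto simp: sym_generators_eq free_group_rank_def inv_free_group_letter inv_letter_def)

lemma finite_sym_generators: "finite (sym_generators k)"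
  by (simp add: sym_generators_eq)

lemma group_prod_Cons [simp]: "group_prod G (x # xs) = x \<otimes>\<^bsub>G\<^esub> group_prod G xs"
  and group_prod_Nil [simp]: "group_prod G [] = \<one>\<^bsub>G\<^esub>"
  by (simp_all add: group_prod_def)

lemma (in group) group_prod_closed [simp]:
  "set xs \<subseteq> carrier G \<Longrightarrow> group_prod G xs \<in> carrier G"
  by (induction xs) auto

lemma (in group) group_prod_append:
  "set xs \<subseteq> carrier G \<Longrightarrow> set ys \<subseteq> carrier G \<Longrightarrow>
    group_prod G (xs @ ys) = group_prod G xs \<otimes> group_prod G ys"
  by (induction xs) (auto simp: m_assoc)

lemma (in group) inv_group_prod:
  "set xs \<subseteq> carrier G \<Longrightarrow> inv (group_prod G xs) = group_prod G (rev (map (m_inv G) xs))"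
proof (induction xs)
  case (Cons x xs)
  moreover have "set (rev (map (m_inv G) xs)) \<subseteq> carrier G"
    using Cons.prems by auto
  ultimately show ?case
    by (simp add: inv_mult_group group_prod_append)
qed simp

lemma sym_generators_power_subset: "sym_generators_power k j \<subseteq> carrier (free_group_rank k)"
  using group.group_prod_closed[OF group_free_group_rank] sym_generators_subset
  unfolding sym_generators_power_def by blast

lemma finite_sym_generators_power: "finite (sym_generators_power k j)"
proof -
  have "sym_generators_power k j =
      group_prod (free_group_rank k) ` {ts. set ts \<subseteq> sym_generators k \<and> length ts = j}"
    by (auto simp: sym_generators_power_def)
  then show ?thesis
    by (simp add: finite_lists_length_eq finite_sym_generators)
qed

lemma inv_sym_generators_power:
  assumes "x \<in> sym_generators_power k j"
  shows "inv\<^bsub>free_group_rank k\<^esub> x \<in> sym_generators_power k j"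
proof -
  obtain ts where ts: "x = group_prod (free_group_rank k) ts" "length ts = j"
      "set ts \<subseteq> sym_generators k"
    using assms by (auto simp: sym_generators_power_def)
  let ?us = "rev (map (m_inv (free_group_rank k)) ts)"
  have "inv\<^bsub>free_group_rank k\<^esub> x = group_prod (free_group_rank k) ?us"
    unfolding ts(1) using ts(3) sym_generators_subset
    by (intro group.inv_group_prod[OF group_free_group_rank]) blast
  moreover have "length ?us = j" "set ?us \<subseteq> sym_generators k"
    using ts inv_sym_generators by auto
  ultimately show ?thesis
    unfolding sym_generators_power_def by blast
qed

text \<open>
  If \<open>\<rho>\<close> is constant on \<open>T\<^sup>j\<close>, then, comparing \<open>s \<cdot> t\<^sup>j\<^sup>-\<^sup>1\<close> with \<open>t\<^sup>j\<close>, it has a constant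
  value \<open>g\<close> on the symmetric set \<open>T\<close>. Hence \<open>g\<close> is its own inverse and the image of \<open>\<rho>\<close> lies
  in \<open>{\<one>, g}\<close>.
\<close>

lemma finite_image_if_constant_on_power:
  assumes "group H" and \<rho>: "\<rho> \<in> hom (free_group_rank k) H" and "j \<ge> 1"
    and const: "\<And>s t. s \<in> sym_generators_power k j \<Longrightarrow> t \<in> sym_generators_power k j \<Longrightarrow> \<rho> s = \<rho> t"
  shows "finite (\<rho> ` carrier (free_group_rank k))"
proof -
  let ?F = "free_group_rank k"
  interpret F: group ?F by (rule group_free_group_rank)
  interpret H: group H by fact
  interpret \<rho>: group_hom ?F H \<rho> by unfold_locales (rule \<rho>)
  have eq: "\<rho> s = \<rho> t" if s: "s \<in> sym_generators k" and t: "t \<in> sym_generators k" for s t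
  proof -
    let ?w = "group_prod ?F (replicate (j - 1) t)"
    have in_F: "s \<in> carrier ?F" "t \<in> carrier ?F"
      using s t sym_generators_subset by auto
    then have w: "?w \<in> carrier ?F"
      by (intro F.group_prod_closed) auto
    have "group_prod ?F (x # replicate (j - 1) t) \<in> sym_generators_power k j"
      if "x \<in> sym_generators k" for x
      unfolding sym_generators_power_def
      using that t \<open>j \<ge> 1\<close> by (intro CollectI exI[of _ "x # replicate (j - 1) t"]) auto
    from const[OF this[OF s] this[OF t]] show ?thesis
      using in_F w by simp
  qed
  \<comment> \<open>For \<open>k = 0\<close> there are no letters, and the group is trivial.\<close>
  define g where "g = (if k = 0 then \<one>\<^bsub>H\<^esub> else \<rho> [(0, True)])"
  have letter: "\<rho> [l] = g" if "fst l < k" for l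
    unfolding g_def using that eq by (cases l) (auto simp: sym_generators_eq)
  have "\<rho> w = \<one>\<^bsub>H\<^esub> \<or> \<rho> w = g" if "w \<in> carrier ?F" for w
    using that
  proof (induction w)
    case Nil
    then show ?case
      using \<rho>.hom_one by (simp add: free_group_rank_def free_group_simps)
  next
    case (Cons l w)
    then have w: "w \<in> carrier ?F" and l: "fst l < k"
      by (auto simp: free_group_rank_def free_group_simps reduced_Cons)
    have lF: "[l] \<in> carrier ?F"
      using l by (simp add: free_group_rank_def free_group_simps reduced_Cons)
    \<comment> \<open>The inverse of a letter is again a letter.\<close>
    have "g = inv\<^bsub>H\<^esub> g"
      using letter[of "inv_letter l"] letter[OF l] l \<rho>.hom_inv[OF lF]
        inv_free_group_letter[of l "{..<k}"]
      by (simp add: free_group_rank_def)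
    moreover have "g \<in> carrier H"
      using letter[OF l] lF \<rho>.hom_closed by metis
    ultimately have "g \<otimes>\<^bsub>H\<^esub> g = \<one>\<^bsub>H\<^esub>" and "g \<otimes>\<^bsub>H\<^esub> \<one>\<^bsub>H\<^esub> = g"
      using H.r_inv[of g] H.r_one[of g] by simp_all
    moreover have "\<rho> (l # w) = g \<otimes>\<^bsub>H\<^esub> \<rho> w"
      using hom_free_group_Cons[of \<rho> "{..<k}" H l w] \<rho> Cons.prems letter[OF l]
      by (simp add: free_group_rank_def)
    ultimately show ?case
      using Cons.IH[OF w] by auto
  qed
  then have "\<rho> ` carrier ?F \<subseteq> {\<one>\<^bsub>H\<^esub>, g}" by auto
  then show ?thesis by (rule finite_subset) simp
qed

section \<open>Closed walks\<close>

text \<open>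
  Follow a walk that never backtracks until its first return to a vertex. The starting points
  of the arcs of the resulting closed walk are distinct, and its second arc is not the reversal
  of its first arc \<open>e\<close>; hence the walk traverses the edge \<open>{e, r e}\<close> exactly once.
\<close>

lemma exists_closed_walk_traversing_edge_once:
  assumes "bidirected_digraph G r" and "fin_digraph G" and "verts G \<noteq> {}"
    and deg: "\<And>v. v \<in> verts G \<Longrightarrow> out_degree G v \<ge> 2"
  shows "\<exists>u e p. pre_digraph.awalk G u (e # p) u \<and> e \<notin> set p \<and> r e \<notin> set p"
proof -
  interpret bidirected_digraph G r by fact
  interpret fin_digraph G by fact
  have "\<exists>e'. e' \<in> arcs G \<and> tail G e' = head G e \<and> e' \<noteq> r e" if "e \<in> arcs G" for e
  proof -
    have "card (out_arcs G (head G e)) \<ge> 2"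
      using deg[of "head G e"] that by (simp add: out_degree_def)
    then have "\<not> out_arcs G (head G e) \<subseteq> {r e}"
      using card_mono[of "{r e}" "out_arcs G (head G e)"] by auto
    then show ?thesis by auto
  qed
  then obtain nxt where nxt: "\<And>e. e \<in> arcs G \<Longrightarrow>
      nxt e \<in> arcs G \<and> tail G (nxt e) = head G e \<and> nxt e \<noteq> r e"
    by metis
  obtain v where "v \<in> verts G" using assms(3) by blast
  then have "out_arcs G v \<noteq> {}"
    using deg[of v] by (auto simp: out_degree_def)
  then obtain e0 where e0: "e0 \<in> arcs G" by auto
  define f where "f i = (nxt ^^ i) e0" for i
  have f: "f i \<in> arcs G" for i
    by (induction i) (use e0 nxt in \<open>auto simp: f_def\<close>)
  have step: "tail G (f (Suc i)) = head G (f i)" "f (Suc i) \<noteq> r (f i)" for i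
    using nxt[OF f[of i]] by (auto simp: f_def)
  have "range (\<lambda>i. tail G (f i)) \<subseteq> verts G" using f by auto
  then have "\<not> inj (\<lambda>i. tail G (f i))"
    using finite_verts finite_subset range_inj_infinite by blast
  then have ex: "\<exists>j. \<exists>i<j. tail G (f i) = tail G (f j)"
    unfolding inj_def by (metis linorder_neqE_nat)
  define j where "j = (LEAST j. \<exists>i<j. tail G (f i) = tail G (f j))"
  obtain i where i: "i < j" "tail G (f i) = tail G (f j)"
    using LeastI_ex[OF ex] unfolding j_def by blast
  have distinct: "a = b" if "a < j" "b < j" "tail G (f a) = tail G (f b)" for a b
    using that not_less_Least[of _ "\<lambda>j. \<exists>i<j. tail G (f i) = tail G (f j)"]
    unfolding j_def[symmetric] by (metis linorder_neqE_nat)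
  let ?p = "map f [Suc i..<j]"
  have cas: "cas (tail G (f a)) (map f [a..<b]) (tail G (f b))" if "a \<le> b" for a b
    using that by (induction rule: inc_induct) (simp_all add: upt_conv_Cons step)
  have "f i # ?p = map f [i..<j]"
    using i(1) by (simp add: upt_conv_Cons)
  then have "awalk (tail G (f i)) (f i # ?p) (tail G (f i))"
    using cas[of i j] i f by (auto simp: awalk_def)
  moreover have "f i \<notin> set ?p"
  proof
    assume "f i \<in> set ?p"
    then obtain b where "Suc i \<le> b" "b < j" "f i = f b" by auto
    then show False using distinct[of i b] i(1) by simp
  qed
  moreover have "r (f i) \<notin> set ?p"
  proof
    assume "r (f i) \<in> set ?p"
    then obtain b where b: "Suc i \<le> b" "b < j" "r (f i) = f b" by auto
    then have "tail G (f b) = tail G (f (Suc i))"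
      using step(1)[of i] tail_arev[OF f[of i]] by simp
    then have "b = Suc i" using distinct[of b "Suc i"] b by auto
    then show False using b(3) step(2)[of i] by simp
  qed
  ultimately show ?thesis by blast
qed

lemma awalk_disjoint_union:
  assumes "pre_digraph.awalk (\<Omega> n) u p v"
  shows "pre_digraph.awalk (disjoint_union \<Omega>) (n, u) (map (Pair n) p) (n, v)"
proof -
  have "pre_digraph.cas (\<Omega> n) u p v \<Longrightarrow>
      pre_digraph.cas (disjoint_union \<Omega>) (n, u) (map (Pair n) p) (n, v)"
    by (induction p arbitrary: u) (auto simp: pre_digraph.cas.simps disjoint_union_def)
  then show ?thesis
    using assms by (auto simp: pre_digraph.awalk_def disjoint_union_def)
qed

section \<open>Random labellings\<close>

lemma finite_labellings:
  "finite (arcs G) \<Longrightarrow> finite L \<Longrightarrow> finite (labellings k G r L)"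
  by (rule finite_subset[of _ "arcs G \<rightarrow>\<^sub>E L"]) (auto simp: labellings_def finite_PiE)

text \<open>
  At most a proportion \<open>1 - 1 / |L|\<close> of the labellings makes \<open>\<rho>\<close> kill the label of \<open>e # p\<close>.
  Indeed, every labelling is obtained from one outside \<open>E\<close> by changing the label of the one edge
  \<open>{e, r e}\<close>: if the labels of all other edges are fixed, the condition that \<open>\<rho>\<close> kills the label
  of \<open>e # p\<close> determines \<open>\<rho> (\<alpha> e)\<close>, while \<open>\<rho>\<close> takes at least two values on \<open>L\<close>.
\<close>

lemma card_labellings_killed_le:
  assumes "bidirected_digraph G r" and "fin_digraph G"
    and H: "group H" and \<rho>: "\<rho> \<in> hom (free_group_rank k) H"
    and L: "finite L" "L \<subseteq> carrier (free_group_rank k)"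
    and L_inv: "\<And>x. x \<in> L \<Longrightarrow> inv\<^bsub>free_group_rank k\<^esub> x \<in> L"
    and st: "s \<in> L" "t \<in> L" "\<rho> s \<noteq> \<rho> t"
    and e: "e \<in> arcs G" and p: "set p \<subseteq> arcs G" "e \<notin> set p" "r e \<notin> set p"
  defines "A \<equiv> labellings k G r L"
  defines "E \<equiv> {\<alpha> \<in> A. \<rho> (group_prod (free_group_rank k) (map \<alpha> (e # p))) = \<one>\<^bsub>H\<^esub>}"
  shows "card A \<le> card L * card (A - E)"
proof -
  let ?F = "free_group_rank k"
  interpret F: group ?F by (rule group_free_group_rank)
  interpret H: group H by fact
  interpret \<rho>: group_hom ?F H \<rho> by unfold_locales (rule \<rho>)
  interpret bidirected_digraph G r by fact
  interpret fin_digraph G by fact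
  \<comment> \<open>\<open>upd x \<alpha>\<close> relabels the edge \<open>{e, r e}\<close> by \<open>x\<close>.\<close>
  define upd where "upd x \<alpha> = \<alpha>(e := x, r e := inv\<^bsub>?F\<^esub> x)" for x and \<alpha> :: "'b \<Rightarrow> nat word"
  have upd_A: "upd x \<alpha> \<in> A" if "x \<in> L" "\<alpha> \<in> A" for x \<alpha>
  proof -
    have "r a = e \<longleftrightarrow> a = r e" "r a = r e \<longleftrightarrow> a = e" for a
      by (metis arev_arev)+
    then show ?thesis
      using that L L_inv e arev_neq[OF e] unfolding A_def labellings_def upd_def
      by (auto simp: PiE_iff extensional_def subset_iff)
  qed
  have upd_upd: "upd (\<alpha> e) (upd x \<alpha>) = \<alpha>" if "\<alpha> \<in> A" for x \<alpha>
    using that e by (auto simp: upd_def A_def labellings_def fun_eq_iff)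
  have good: "\<exists>x\<in>L. upd x \<alpha> \<notin> E" if "\<alpha> \<in> A" for \<alpha>
  proof (rule ccontr)
    assume "\<not> (\<exists>x\<in>L. upd x \<alpha> \<notin> E)"
    then have E: "upd s \<alpha> \<in> E" "upd t \<alpha> \<in> E" using st by auto
    define w where "w = group_prod ?F (map \<alpha> p)"
    have "set (map \<alpha> p) \<subseteq> carrier ?F"
      using that p(1) L(2) by (auto simp: A_def labellings_def)
    then have w: "w \<in> carrier ?F"
      unfolding w_def by (rule F.group_prod_closed)
    have "map (upd x \<alpha>) p = map \<alpha> p" and "upd x \<alpha> e = x" for x
      using p arev_neq[OF e] by (auto simp: upd_def)
    then have "group_prod ?F (map (upd x \<alpha>) (e # p)) = x \<otimes>\<^bsub>?F\<^esub> w" for x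
      unfolding w_def by (simp only: list.map group_prod_Cons)
    then have "\<rho> x \<otimes>\<^bsub>H\<^esub> \<rho> w = \<one>\<^bsub>H\<^esub>" if "x \<in> L" "upd x \<alpha> \<in> E" for x
      using that w L(2) \<rho>.hom_mult[of x w] unfolding E_def by (auto simp: subset_iff)
    then have "\<rho> s \<otimes>\<^bsub>H\<^esub> \<rho> w = \<rho> t \<otimes>\<^bsub>H\<^esub> \<rho> w"
      using E st by metis
    then show False
      using st w L(2) by (auto simp: subset_iff)
  qed
  have fin: "finite A"
    unfolding A_def using finite_labellings[OF finite_arcs L(1)] .
  have "A \<subseteq> (\<lambda>(x, \<beta>). upd x \<beta>) ` (L \<times> (A - E))"
  proof
    fix \<alpha> assume \<alpha>: "\<alpha> \<in> A"
    then obtain x where x: "x \<in> L" "upd x \<alpha> \<notin> E" using good by blast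
    have "\<alpha> e \<in> L" using \<alpha> e by (auto simp: A_def labellings_def)
    then show "\<alpha> \<in> (\<lambda>(x, \<beta>). upd x \<beta>) ` (L \<times> (A - E))"
      using x upd_A[OF x(1) \<alpha>] upd_upd[OF \<alpha>, of x]
      by (intro image_eqI[of _ _ "(\<alpha> e, upd x \<alpha>)"]) auto
  qed
  then have "card A \<le> card (L \<times> (A - E))"
    using fin L(1) by (intro surj_card_le) auto
  then show ?thesis by (simp add: card_cartesian_product)
qed

text \<open>
  Independent events whose probabilities are bounded away from 1 almost surely do not all occur.
\<close>

lemma AE_PiM_ex_notin:
  fixes M :: "nat \<Rightarrow> 'a measure"
  assumes "\<And>n. prob_space (M n)" and E: "\<And>n. E n \<in> sets (M n)"
    and le: "\<And>n. measure (M n) (E n) \<le> c" and "c < 1"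
  shows "AE x in Pi\<^sub>M UNIV M. \<exists>n. x n \<notin> E n"
proof -
  interpret M: prob_space "M n" for n by fact
  interpret product_prob_space M UNIV by unfold_locales
  let ?P = "Pi\<^sub>M UNIV M"
  let ?Z = "\<lambda>J. {x \<in> space ?P. \<forall>i\<in>J. x i \<in> E i}"
  have c: "0 \<le> c"
    using le[of 0] measure_nonneg[of "M 0" "E 0"] by linarith
  have meas: "?Z J \<in> sets ?P" for J
    using E by measurable
  have "emeasure ?P (?Z UNIV) \<le> ennreal (c ^ N)" for N
  proof -
    have "emeasure ?P (?Z UNIV) \<le> emeasure ?P (?Z {..<N})"
      using meas by (intro emeasure_mono) auto
    also have "\<dots> = (\<Prod>i<N. emeasure (M i) (E i))"
      using E by (intro emeasure_PiM_Collect) auto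
    also have "\<dots> \<le> (\<Prod>i<N. ennreal c)"
      using le by (intro prod_mono_ennreal) (simp add: M.emeasure_eq_measure ennreal_leI)
    also have "\<dots> = ennreal (c ^ N)"
      using c by (simp add: ennreal_power)
    finally show ?thesis .
  qed
  moreover have "(\<lambda>N. ennreal (c ^ N)) \<longlonglongrightarrow> ennreal 0"
    using c \<open>c < 1\<close> by (intro tendsto_ennrealI LIMSEQ_power_zero) auto
  ultimately have "emeasure ?P (?Z UNIV) \<le> 0"
    by (intro LIMSEQ_le_const[of _ "0::ennreal"]) auto
  then have "?Z UNIV \<in> null_sets ?P"
    using meas[of UNIV] by (simp add: null_sets_def)
  then show ?thesis
    by (rule AE_I') auto
qed

section \<open>Homomorphisms to countable groups\<close>

lemma AE_closed_path_label_survives: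
  fixes \<Omega> :: "nat \<Rightarrow> ('v, 'e) pre_digraph"
  assumes bi: "\<And>n. bidirected_digraph (\<Omega> n) (r n)" and fin: "\<And>n. fin_digraph (\<Omega> n)"
    and ne: "\<And>n. verts (\<Omega> n) \<noteq> {}"
    and deg: "\<And>n v. v \<in> verts (\<Omega> n) \<Longrightarrow> out_degree (\<Omega> n) v \<ge> 2"
    and "j \<ge> 1" and H: "group H" and \<rho>: "\<rho> \<in> hom (free_group_rank k) H"
    and inf: "infinite (\<rho> ` carrier (free_group_rank k))"
  shows "AE \<alpha> in random_labelling k \<Omega> r j.
    \<exists>x \<in> closed_path_labels k (disjoint_union \<Omega>) (\<lambda>(n, e). \<alpha> n e). \<rho> x \<noteq> \<one>\<^bsub>H\<^esub>"
proof -
  let ?F = "free_group_rank k"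
  define L where "L = sym_generators_power k j"
  define A where "A n = labellings k (\<Omega> n) (r n) L" for n
  have L: "finite L" "L \<subseteq> carrier ?F" "\<And>x. x \<in> L \<Longrightarrow> inv\<^bsub>?F\<^esub> x \<in> L"
    unfolding L_def
    using finite_sym_generators_power sym_generators_power_subset inv_sym_generators_power
    by auto
  obtain s t where st: "s \<in> L" "t \<in> L" "\<rho> s \<noteq> \<rho> t"
    using finite_image_if_constant_on_power[OF H \<rho> \<open>j \<ge> 1\<close>] inf unfolding L_def by metis
  have finA: "finite (A n)" for n
    unfolding A_def using fin_digraph.finite_arcs[OF fin] L(1) by (rule finite_labellings)
  have "\<exists>u e p. pre_digraph.awalk (\<Omega> n) u (e # p) u \<and> e \<notin> set p \<and> r n e \<notin> set p" for n
    by (rule exists_closed_walk_traversing_edge_once[OF bi fin ne deg])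
  then obtain u e p where walk: "\<And>n. pre_digraph.awalk (\<Omega> n) (u n) (e n # p n) (u n)"
    and once: "\<And>n. e n \<notin> set (p n)" "\<And>n. r n (e n) \<notin> set (p n)"
    by metis
  define E where
    "E n = {\<alpha> \<in> A n. \<rho> (group_prod ?F (map \<alpha> (e n # p n))) = \<one>\<^bsub>H\<^esub>}" for n
  define c where "c = 1 - 1 / real (card L)"
  have cardL: "card L > 0"
    using L(1) st(1) by (auto simp: card_gt_0_iff)
  have survive: "\<exists>x \<in> closed_path_labels k (disjoint_union \<Omega>) (\<lambda>(n, e). \<alpha> n e). \<rho> x \<noteq> \<one>\<^bsub>H\<^esub>"
    if "\<alpha> n \<in> A n - E n" for \<alpha> n
  proof -
    have "group_prod ?F (map (\<lambda>(n, e). \<alpha> n e) (map (Pair n) (e n # p n)))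
        \<in> closed_path_labels k (disjoint_union \<Omega>) (\<lambda>(n, e). \<alpha> n e)"
      using awalk_disjoint_union[of \<Omega> n, OF walk] unfolding closed_path_labels_def by blast
    moreover have "map (\<lambda>(n, e). \<alpha> n e) (map (Pair n) (e n # p n)) = map (\<alpha> n) (e n # p n)"
      by simp
    ultimately have "group_prod ?F (map (\<alpha> n) (e n # p n))
        \<in> closed_path_labels k (disjoint_union \<Omega>) (\<lambda>(n, e). \<alpha> n e)"
      by (simp only:)
    then show ?thesis
      using that unfolding E_def by blast
  qed
  have space: "space (random_labelling k \<Omega> r j) = (\<Pi>\<^sub>E n\<in>UNIV. A n)"
    by (simp add: random_labelling_def A_def L_def space_PiM space_uniform_count_measure)
  show ?thesis
  proof (cases "\<exists>n. A n = {}")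
    \<comment> \<open>If some graph had no labelling at all, the product space would be empty.\<close>
    case True
    then show ?thesis
      using space by (intro AE_I2) (auto simp: PiE_iff)
  next
    case False
    have "prob_space (uniform_count_measure (A n))" for n
      using False finA by (intro prob_space_uniform_count_measure) auto
    moreover have "E n \<in> sets (uniform_count_measure (A n))" for n
      by (auto simp: E_def sets_uniform_count_measure)
    moreover have "measure (uniform_count_measure (A n)) (E n) \<le> c" for n
    proof -
      have sub: "E n \<subseteq> A n" by (auto simp: E_def)
      have "set (p n) \<subseteq> arcs (\<Omega> n)" "e n \<in> arcs (\<Omega> n)"
        using walk[of n] by (auto simp: pre_digraph.awalk_def)
      then have "card (A n) \<le> card L * card (A n - E n)"
        unfolding A_def E_def
        using card_labellings_killed_le[OF bi fin H \<rho> L st] once by blast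
      also have "card (A n - E n) = card (A n) - card (E n)"
        using sub finA by (simp add: card_Diff_subset finite_subset)
      finally have "real (card (A n)) \<le> real (card L) * (real (card (A n)) - real (card (E n)))"
        using card_mono[OF finA sub] by (metis of_nat_diff of_nat_le_iff of_nat_mult)
      moreover have "card (A n) > 0"
        using False finA by (simp add: card_gt_0_iff)
      ultimately have "real (card (E n)) / real (card (A n)) \<le> c"
        using cardL unfolding c_def by (subst pos_divide_le_eq) (simp_all add: field_simps)
      then show ?thesis
        using sub finA by (simp add: measure_uniform_count_measure)
    qed
    moreover have "c < 1"
      using cardL by (simp add: c_def)
    ultimately have "AE \<alpha> in random_labelling k \<Omega> r j. \<exists>n. \<alpha> n \<notin> E n"
      unfolding random_labelling_def L_def[symmetric] A_def[symmetric]
      by (rule AE_PiM_ex_notin)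
    moreover have "AE \<alpha> in random_labelling k \<Omega> r j. \<forall>n. \<alpha> n \<in> A n"
      using space by (intro AE_I2) (auto simp: PiE_iff)
    ultimately show ?thesis
    proof eventually_elim
      case (elim \<alpha>)
      then show ?case using survive by blast
    qed
  qed
qed

lemma closed_path_labels_subset:
  assumes "\<And>n. \<alpha> n \<in> labellings k (\<Omega> n) (r n) L" and "L \<subseteq> carrier (free_group_rank k)"
  shows "closed_path_labels k (disjoint_union \<Omega>) (\<lambda>(n, e). \<alpha> n e) \<subseteq> carrier (free_group_rank k)"
proof
  fix x assume "x \<in> closed_path_labels k (disjoint_union \<Omega>) (\<lambda>(n, e). \<alpha> n e)"
  then obtain u p where x: "x = group_prod (free_group_rank k) (map (\<lambda>(n, e). \<alpha> n e) p)"
    and "pre_digraph.awalk (disjoint_union \<Omega>) u p u"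
    by (auto simp: closed_path_labels_def)
  then have "set p \<subseteq> (SIGMA n:UNIV. arcs (\<Omega> n))"
    by (auto simp: pre_digraph.awalk_def disjoint_union_def)
  moreover have "\<alpha> n e \<in> L" if "e \<in> arcs (\<Omega> n)" for n e
    using assms(1)[of n] that by (auto simp: labellings_def)
  ultimately have "set (map (\<lambda>(n, e). \<alpha> n e) p) \<subseteq> carrier (free_group_rank k)"
    using assms(2) by fastforce
  then show "x \<in> carrier (free_group_rank k)"
    unfolding x by (rule group.group_prod_closed[OF group_free_group_rank])
qed

theorem AE_finite_image_countable_group:
  fixes \<Omega> :: "nat \<Rightarrow> ('v, 'e) pre_digraph"
  assumes bi: "\<And>n. bidirected_digraph (\<Omega> n) (r n)" and fin: "\<And>n. fin_digraph (\<Omega> n)"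
    and ne: "\<And>n. verts (\<Omega> n) \<noteq> {}"
    and deg: "\<And>n v. v \<in> verts (\<Omega> n) \<Longrightarrow> out_degree (\<Omega> n) v \<ge> 2"
    and "j \<ge> 1" and H: "group H" "countable (carrier H)"
  shows "AE \<alpha> in random_labelling k \<Omega> r j.
    \<forall>h \<in> hom (monster_group k \<Omega> \<alpha>) H. finite (h ` carrier (monster_group k \<Omega> \<alpha>))"
proof -
  let ?F = "free_group_rank k"
  let ?R = "\<lambda>\<alpha>. closed_path_labels k (disjoint_union \<Omega>) (\<lambda>(n, e). \<alpha> n e)"
  define HomF where "HomF = (\<lambda>\<rho>. restrict \<rho> (carrier ?F)) ` hom ?F H"
  have "countable HomF"
    unfolding HomF_def free_group_rank_def by (rule countable_hom_free_group[OF H]) simp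
  moreover have "AE \<alpha> in random_labelling k \<Omega> r j.
      infinite (\<rho> ` carrier ?F) \<longrightarrow> (\<exists>x \<in> ?R \<alpha>. \<rho> x \<noteq> \<one>\<^bsub>H\<^esub>)" if "\<rho> \<in> HomF" for \<rho>
  proof -
    have "\<rho> \<in> hom ?F H"
      using that group.is_monoid[OF group_free_group_rank, of k]
      by (auto simp: HomF_def hom_def monoid.m_closed)
    then show ?thesis
      using AE_closed_path_label_survives[OF bi fin ne deg \<open>j \<ge> 1\<close> H(1)]
      by (cases "infinite (\<rho> ` carrier ?F)") auto
  qed
  ultimately have survives: "AE \<alpha> in random_labelling k \<Omega> r j. \<forall>\<rho> \<in> HomF.
      infinite (\<rho> ` carrier ?F) \<longrightarrow> (\<exists>x \<in> ?R \<alpha>. \<rho> x \<noteq> \<one>\<^bsub>H\<^esub>)"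
    by (simp add: AE_ball_countable)
  have "AE \<alpha> in random_labelling k \<Omega> r j. ?R \<alpha> \<subseteq> carrier ?F"
  proof (rule AE_I2)
    fix \<alpha> assume "\<alpha> \<in> space (random_labelling k \<Omega> r j)"
    then have "\<alpha> n \<in> labellings k (\<Omega> n) (r n) (sym_generators_power k j)" for n
      by (auto simp: random_labelling_def space_PiM space_uniform_count_measure)
    then show "?R \<alpha> \<subseteq> carrier ?F"
      by (rule closed_path_labels_subset[OF _ sym_generators_power_subset])
  qed
  with survives show ?thesis
  proof eventually_elim
    case (elim \<alpha>)
    show ?case
    proof
      fix h assume h: "h \<in> hom (monster_group k \<Omega> \<alpha>) H"
      define \<rho> where "\<rho> x = h (normal_closure ?F (?R \<alpha>) #>\<^bsub>?F\<^esub> x)" for x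
      note \<rho> = group.hom_Mod_normal_closure[OF group_free_group_rank elim(2) H(1)
          h[unfolded monster_group_def], folded \<rho>_def monster_group_def]
      \<comment> \<open>Only the values of \<open>\<rho>\<close> on the carrier matter, and restricting to it makes the set
        of homomorphisms countable.\<close>
      have "restrict \<rho> (carrier ?F) \<in> HomF"
        using \<rho>(1) by (auto simp: HomF_def)
      moreover have "restrict \<rho> (carrier ?F) x = \<one>\<^bsub>H\<^esub>" if "x \<in> ?R \<alpha>" for x
        using \<rho>(3)[OF that] that elim(2) by auto
      ultimately have "finite (restrict \<rho> (carrier ?F) ` carrier ?F)"
        using elim(1) by blast
      then show "finite (h ` carrier (monster_group k \<Omega> \<alpha>))"
        by (simp add: \<rho>(2))
    qed
  qed
qed

theorem corollary1p2:
  fixes d k m j :: nat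
    and \<Omega> :: "nat \<Rightarrow> ('v, 'e) pre_digraph"
    and r :: "nat \<Rightarrow> 'e \<Rightarrow> 'e"
  assumes "d \<ge> 3" and "k \<ge> 2"
    and "\<And>n. bidirected_digraph (\<Omega> n) (r n)"
    and "\<And>n. fin_digraph (\<Omega> n)"
    and "\<And>n. Digraph_Component.connected (\<Omega> n)"
    and "\<And>n v. v \<in> verts (\<Omega> n) \<Longrightarrow> out_degree (\<Omega> n) v = d"
    and "expander \<Omega>" and "dg_bounded \<Omega> r" and "large_girth \<Omega> r"
    and "m \<ge> 1" and "j \<ge> 1"
  shows "AE \<alpha> in random_labelling k \<Omega> r j.
    \<forall>h \<in> hom (monster_group k \<Omega> \<alpha>) (braid_group m).
      finite (h ` carrier (monster_group k \<Omega> \<alpha>))"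
proof (rule AE_finite_image_countable_group)
  fix n
  show "bidirected_digraph (\<Omega> n) (r n)" "fin_digraph (\<Omega> n)" by fact+
  show "verts (\<Omega> n) \<noteq> {}"
    using assms(5)[of n]
    by (simp add: Digraph_Component.connected_def strongly_connected_def)
  show "2 \<le> out_degree (\<Omega> n) v" if "v \<in> verts (\<Omega> n)" for v
    using assms(6)[OF that] \<open>d \<ge> 3\<close> by simp
qed (use \<open>j \<ge> 1\<close> group_braid_group countable_braid_group in auto)

end
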